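(* Let $v\in V$. Let $\mathcal{D}_v^1$ be the feasible set of the big-M system (B) at $v$ and $\bar{\mathcal{D}}_v^1$ the feasible set of its continuous relaxation; let $\mathcal{D}_v^2$ be the feasible set of the disjunctive programming system (P) at $v$ and $\bar{\mathcal{D}}_v^2$ the feasible set of its continuous relaxation (both systems are written out in the context; $\mathcal{D}_v^2$ and $\bar{\mathcal{D}}_v^2$ are regarded as subsets of the space of the variables $(x_v,(z_{ve'i'}),r_v,(q_{e'}))$ by projecting out the additional continuous variables of (P)). Then $$\mathcal{D}_v^1=\mathcal{D}_v^2\subseteq \operatorname{conv}(\mathcal{D}_v^2)=\bar{\mathcal{D}}_v^2\subseteq\bar{\mathcal{D}}_v^1 .$$
   Context: Network. $N=(V,E,\ell)$ is a finite undirected connected network with edge lengths $\ell_e\in\mathbb{R}_+$. $V$ is totally ordered and each edge is written uniquely $e=(v_a,v_b)$ with $v_a\preceq v_b$; for $e'\in E$ write $e'=(v'_a,v'_b)$. $C(N)$ is the continuum of all points on edges and vertices of $N$ (an edge $e$ is also regarded as the continuum of its points) and $d(\cdot,\cdot)$ is the shortest-path distance on $C(N)$. $\delta>0$ is a fixed real number (covering radius), and it is assumed throughout that $\delta\ge \ell_e$ for all $e\in E$. Delimitation sets. $E(v)=\{e\in E: v\in e\}$ is the set of edges incident to $v$. $\mathcal{E}(v)=\{e'=(v'_a,v'_b)\in E: d(v,v'_i)\le\delta \text{ for some } i\in\{a,b\}\}$. $\mathcal{E}_{\mathrm c}(e)=\{e'\in E: d(p,p')\le\delta\ \ \forall p'\in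 e',\ \forall p\in e\}$. $\mathcal{E}_{\mathrm p}(v)=\{e'\in\mathcal{E}(v): \exists e\in E(v),\ e'\notin \mathcal{E}_{\mathrm c}(e)\}$. $\Pi_{\mathrm p}(v)=\{(e'=(v'_a,v'_b),i')\in\mathcal{E}_{\mathrm p}(v)\times\{a,b\}: d(v,v'_{i'})\le\delta\}$. Affine functions. For $(e',i')\in\Pi_{\mathrm p}(v)$, $$\tau_{ve'i'}(t)=d(v,v'_{i'})+\mathbf 1_{i'=a}\,t+\mathbf 1_{i'=b}(\ell_{e'}-t),$$ $$R_{ve'i'}(s,y)=(\delta-d(v,v'_{i'})-\mathbf 1_{i'=b}\ell_{e'})\,y+(\mathbf 1_{i'=b}-\mathbf 1_{i'=a})\,s.$$ System (B) at $v$, in variables $x_v$, $(z_{ve'i'})_{(e',i')\in\Pi_{\mathrm p}(v)}$, $r_v$, $(q_{e'})_{e'\in\mathcal{E}_{\mathrm p}(v)}$: - $x_v+\sum_{(e',i')\in\Pi_{\mathrm p}(v)}z_{ve'i'}=1$; - $r_v\le M_v(1-x_v)$; - $r_v\le M_{ve'i'}(1-z_{ve'i'})+\delta-\tau_{ve'i'}(q_{e'})$ for $(e',i')\in\Pi_{\mathrm p}(v)$; - $z_{ve'i'}\in\{0,1\}$ for $(e',i')\in\Pi_{\mathrm p}(v)$; $q_{e'}\in[0,\ell_{e'}]$ for $e'\in\mathcal{E}_{\mathrm p}(v)$; $x_v\in\{0,1\}$; $r_v\ge0$. Here $M_v, M_{ve'i'}$ are real constants that are valid big-M constants, meaning that for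 all $q_{e'}\in[0,\ell_{e'}]$ and $r_v\ge 0$: (i) if $r_v\le\delta-\tau_{ve'i'}(q_{e'})$ for some $(e',i')\in\Pi_{\mathrm p}(v)$, then $r_v\le M_v$ and $r_v\le M_{vfj}+\delta-\tau_{vfj}(q_f)$ for all other $(f,j)\in\Pi_{\mathrm p}(v)$; (ii) if $r_v=0$, then $r_v\le M_{vfj}+\delta-\tau_{vfj}(q_f)$ for all $(f,j)\in\Pi_{\mathrm p}(v)$. For example $M_v=\delta$, $M_{ve'i'}=\delta+\ell_{e'}$ are valid. System (P) at $v$, in the variables of (B) together with additional continuous variables $r_{ve'i'},q_{ve'i'}$ ($(e',i')\in\Pi_{\mathrm p}(v)$) and $q_{ve'}$ ($e'\in\mathcal{E}_{\mathrm p}(v)$): - $x_v+\sum_{(e',i')\in\Pi_{\mathrm p}(v)}z_{ve'i'}=1$; - $r_v=\sum_{(e',i')\in\Pi_{\mathrm p}(v)}r_{ve'i'}$; - $q_{e'}=q_{ve'}+\sum_{i':(e',i')\in\Pi_{\mathrm p}(v)}q_{ve'i'}$ for $e'\in\mathcal{E}_{\mathrm p}(v)$; - $r_{ve'i'}\le R_{ve'i'}(q_{ve'i'},z_{ve'i'})$ for $(e',i')\in\Pi_{\mathrm p}(v)$; - $q_{ve'i'}\le z_{ve'i'}\ell_{e'}$ for $(e',i')\in\Pi_{\mathrm p}(v)$; - $q_{ve'}\le\bigl(1-\sum_{i':(e',i')\in\Pi_{\mathrm p}(v)}z_{ve'i'}\bigr)\ell_{e'}$ for $e'\in\mathcal{E}_{\mathrm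 p}(v)$; - $z_{ve'i'}\in\{0,1\}$, $r_{ve'i'}\ge0$, $q_{ve'i'}\ge0$ for $(e',i')\in\Pi_{\mathrm p}(v)$; $q_{e'}\ge0$, $q_{ve'}\ge0$ for $e'\in\mathcal{E}_{\mathrm p}(v)$; $x_v\in\{0,1\}$; $r_v\ge0$. The continuous relaxation of a system is obtained by replacing each constraint "$\in\{0,1\}$" by "$\in[0,1]$". $\operatorname{conv}$ denotes convex hull. *)

theory Defs
  imports "HOL-Analysis.Analysis"
begin

text \<open>
  The vertex set of a network is (the universe of) a finite linearly ordered type \<open>'v\<close>.
  An edge is the pair of its end vertices, smaller one first.
\<close>

type_synonym 'v edge = "'v \<times> 'v"

datatype side = SideA | SideB

instance side :: finite
proof
  have "(UNIV :: side set) = {SideA, SideB}"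
    using side.exhaust by auto
  then show "finite (UNIV :: side set)"
    by (metis finite.emptyI finite_insert)
qed

fun end_vertex :: "'v edge \<Rightarrow> side \<Rightarrow> 'v" where
  "end_vertex (a, b) SideA = a"
| "end_vertex (a, b) SideB = b"

locale network =
  fixes E :: "'v :: {finite, linorder} edge set"
    and l :: "'v edge \<Rightarrow> real"
  assumes edge_ordered: "(a, b) \<in> E \<Longrightarrow> a \<le> b"
    and length_nonneg: "e \<in> E \<Longrightarrow> 0 \<le> l e"
    and connected: "(u, w) \<in> (E \<union> E\<inverse>)\<^sup>*"


subsection \<open>The continuum of points and the shortest-path distance\<close>

text \<open>
  \<open>OnEdge e t\<close> is the point of \<open>e\<close> at distance \<open>t\<close> from its first end, measured along \<open>e\<close>.
  The ends of \<open>e\<close> are therefore represented twice, as \<open>OnEdge e 0\<close>, \<open>OnEdge e (l e)\<close> and as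
  vertices; the two representatives are at distance 0 from each other, and no identification
  is made because points are only used through their distances.
\<close>

datatype 'v point = Vertex 'v | OnEdge "'v edge" real

text \<open>\<open>located E l e p t\<close>: the point \<open>p\<close> lies on the edge \<open>e\<close> at position \<open>t\<close>.\<close>

inductive located :: "'v edge set \<Rightarrow> ('v edge \<Rightarrow> real) \<Rightarrow> 'v edge \<Rightarrow> 'v point \<Rightarrow> real \<Rightarrow> bool"
  for E l where
  "e \<in> E \<Longrightarrow> located E l e (Vertex (fst e)) 0"
| "e \<in> E \<Longrightarrow> located E l e (Vertex (snd e)) (l e)"
| "e \<in> E \<Longrightarrow> 0 \<le> t \<Longrightarrow> t \<le> l e \<Longrightarrow> located E l e (OnEdge e t) t"

definition edge_points :: "'v edge set \<Rightarrow> ('v edge \<Rightarrow> real) \<Rightarrow> 'v edge \<Rightarrow> 'v point set" where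
  "edge_points E l e = {p. \<exists>t. located E l e p t}"

text \<open>
  \<open>net_path E l p c p'\<close>: there is a path of length \<open>c\<close> from \<open>p\<close> to \<open>p'\<close>, i.e. a finite concatenation
  of segments, each contained in a single edge.
\<close>

inductive net_path :: "'v edge set \<Rightarrow> ('v edge \<Rightarrow> real) \<Rightarrow> 'v point \<Rightarrow> real \<Rightarrow> 'v point \<Rightarrow> bool"
  for E l where
  "net_path E l p 0 p"
| "net_path E l p c p' \<Longrightarrow> located E l e p' s \<Longrightarrow> located E l e p'' t \<Longrightarrow>
     net_path E l p (c + \<bar>s - t\<bar>) p''"

definition net_dist :: "'v edge set \<Rightarrow> ('v edge \<Rightarrow> real) \<Rightarrow> 'v point \<Rightarrow> 'v point \<Rightarrow> real" where
  "net_dist E l p p' = Inf {c. net_path E l p c p'}"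

definition end_dist ::
  "'v edge set \<Rightarrow> ('v edge \<Rightarrow> real) \<Rightarrow> 'v \<Rightarrow> 'v edge \<times> side \<Rightarrow> real" where
  "end_dist E l v k = net_dist E l (Vertex v) (Vertex (end_vertex (fst k) (snd k)))"


subsection \<open>Delimitation sets\<close>

definition incident :: "'v edge set \<Rightarrow> 'v \<Rightarrow> 'v edge set" where
  "incident E v = {e \<in> E. v = fst e \<or> v = snd e}"

definition potential :: "'v edge set \<Rightarrow> ('v edge \<Rightarrow> real) \<Rightarrow> real \<Rightarrow> 'v \<Rightarrow> 'v edge set" where
  "potential E l \<delta> v = {e' \<in> E. \<exists>i. end_dist E l v (e', i) \<le> \<delta>}"

definition complete_cover ::
  "'v edge set \<Rightarrow> ('v edge \<Rightarrow> real) \<Rightarrow> real \<Rightarrow> 'v edge \<Rightarrow> 'v edge set" where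
  "complete_cover E l \<delta> e =
     {e' \<in> E. \<forall>p' \<in> edge_points E l e'. \<forall>p \<in> edge_points E l e. net_dist E l p p' \<le> \<delta>}"

definition partial_cover :: "'v edge set \<Rightarrow> ('v edge \<Rightarrow> real) \<Rightarrow> real \<Rightarrow> 'v \<Rightarrow> 'v edge set" where
  "partial_cover E l \<delta> v =
     {e' \<in> potential E l \<delta> v. \<exists>e \<in> incident E v. e' \<notin> complete_cover E l \<delta> e}"

definition partial_pairs ::
  "'v edge set \<Rightarrow> ('v edge \<Rightarrow> real) \<Rightarrow> real \<Rightarrow> 'v \<Rightarrow> ('v edge \<times> side) set" where
  "partial_pairs E l \<delta> v =
     {(e', i'). e' \<in> partial_cover E l \<delta> v \<and> end_dist E l v (e', i') \<le> \<delta>}"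


subsection \<open>The two systems at a vertex\<close>

definition tau ::
  "'v edge set \<Rightarrow> ('v edge \<Rightarrow> real) \<Rightarrow> 'v \<Rightarrow> 'v edge \<times> side \<Rightarrow> real \<Rightarrow> real" where
  "tau E l v k t =
     end_dist E l v k + of_bool (snd k = SideA) * t + of_bool (snd k = SideB) * (l (fst k) - t)"

definition residual ::
  "'v edge set \<Rightarrow> ('v edge \<Rightarrow> real) \<Rightarrow> real \<Rightarrow> 'v \<Rightarrow> 'v edge \<times> side \<Rightarrow> real \<Rightarrow> real \<Rightarrow> real" where
  "residual E l \<delta> v k s y =
     (\<delta> - end_dist E l v k - of_bool (snd k = SideB) * l (fst k)) * y
     + (of_bool (snd k = SideB) - of_bool (snd k = SideA)) * s"

definition valid_bigM ::
  "'v edge set \<Rightarrow> ('v edge \<Rightarrow> real) \<Rightarrow> real \<Rightarrow> 'v \<Rightarrow> real \<Rightarrow> ('v edge \<times> side \<Rightarrow> real) \<Rightarrow> bool" where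
  "valid_bigM E l \<delta> v Mv M \<longleftrightarrow>
     (\<forall>q r. (\<forall>e \<in> partial_cover E l \<delta> v. q e \<in> {0..l e}) \<and> 0 \<le> r \<longrightarrow>
        (\<forall>k \<in> partial_pairs E l \<delta> v. r \<le> \<delta> - tau E l v k (q (fst k)) \<longrightarrow>
           r \<le> Mv \<and>
           (\<forall>k' \<in> partial_pairs E l \<delta> v - {k}. r \<le> M k' + \<delta> - tau E l v k' (q (fst k')))) \<and>
        (r = 0 \<longrightarrow>
           (\<forall>k \<in> partial_pairs E l \<delta> v. r \<le> M k + \<delta> - tau E l v k (q (fst k)))))"

text \<open>
  A point of the space of the variables \<open>x\<close>, \<open>z\<close>, \<open>r\<close>, \<open>q\<close>, in this order. The components \<open>z\<close> and
  \<open>q\<close> are indexed by all pairs (edge, side) and all edges; \<open>supported\<close> cuts the space down to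
  the coordinate subspace in which only the variables that occur in the systems can be nonzero.
\<close>

type_synonym 'v vars =
  "real \<times> (real, 'v edge \<times> side) vec \<times> real \<times> (real, 'v edge) vec"

definition supported ::
  "'v::finite edge set \<Rightarrow> ('v edge \<Rightarrow> real) \<Rightarrow> real \<Rightarrow> 'v \<Rightarrow> 'v vars set" where
  "supported E l \<delta> v =
     {(x, z, r, q). (\<forall>k. k \<notin> partial_pairs E l \<delta> v \<longrightarrow> z $ k = 0) \<and>
                    (\<forall>e. e \<notin> partial_cover E l \<delta> v \<longrightarrow> q $ e = 0)}"

text \<open>
  Both systems take the domain \<open>S\<close> of the binary variables as a parameter: \<open>{0, 1}\<close> for the
  mixed-integer system, \<open>{0..1}\<close> for its continuous relaxation.
\<close>

definition bigM_system ::
  "real set \<Rightarrow> 'v::finite edge set \<Rightarrow> ('v edge \<Rightarrow> real) \<Rightarrow> real \<Rightarrow> 'v \<Rightarrow>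
     real \<Rightarrow> ('v edge \<times> side \<Rightarrow> real) \<Rightarrow> 'v vars set" where
  "bigM_system S E l \<delta> v Mv M =
     {(x, z, r, q) \<in> supported E l \<delta> v.
        x + (\<Sum>k \<in> partial_pairs E l \<delta> v. z $ k) = 1 \<and>
        r \<le> Mv * (1 - x) \<and>
        (\<forall>k \<in> partial_pairs E l \<delta> v.
           r \<le> M k * (1 - z $ k) + \<delta> - tau E l v k (q $ fst k)) \<and>
        (\<forall>k \<in> partial_pairs E l \<delta> v. z $ k \<in> S) \<and>
        (\<forall>e \<in> partial_cover E l \<delta> v. q $ e \<in> {0..l e}) \<and>
        x \<in> S \<and> 0 \<le> r}"

text \<open>
  The existentially quantified \<open>rp\<close>, \<open>qp\<close> (indexed by pairs) and \<open>qn\<close> (indexed by edges) are the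
  additional continuous variables, which are thereby projected out.
\<close>

definition disjunctive_system ::
  "real set \<Rightarrow> 'v::finite edge set \<Rightarrow> ('v edge \<Rightarrow> real) \<Rightarrow> real \<Rightarrow> 'v \<Rightarrow> 'v vars set" where
  "disjunctive_system S E l \<delta> v =
     {(x, z, r, q) \<in> supported E l \<delta> v.
        \<exists>(rp :: 'v edge \<times> side \<Rightarrow> real) (qp :: 'v edge \<times> side \<Rightarrow> real) (qn :: 'v edge \<Rightarrow> real).
          x + (\<Sum>k \<in> partial_pairs E l \<delta> v. z $ k) = 1 \<and>
          r = (\<Sum>k \<in> partial_pairs E l \<delta> v. rp k) \<and>
          (\<forall>e \<in> partial_cover E l \<delta> v.
             q $ e = qn e + (\<Sum>i | (e, i) \<in> partial_pairs E l \<delta> v. qp (e, i))) \<and>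
          (\<forall>k \<in> partial_pairs E l \<delta> v. rp k \<le> residual E l \<delta> v k (qp k) (z $ k)) \<and>
          (\<forall>k \<in> partial_pairs E l \<delta> v. qp k \<le> z $ k * l (fst k)) \<and>
          (\<forall>e \<in> partial_cover E l \<delta> v.
             qn e \<le> (1 - (\<Sum>i | (e, i) \<in> partial_pairs E l \<delta> v. z $ (e, i))) * l e) \<and>
          (\<forall>k \<in> partial_pairs E l \<delta> v. z $ k \<in> S \<and> 0 \<le> rp k \<and> 0 \<le> qp k) \<and>
          (\<forall>e \<in> partial_cover E l \<delta> v. 0 \<le> q $ e \<and> 0 \<le> qn e) \<and>
          x \<in> S \<and> 0 \<le> r}"

end

theory Submission
  imports Defs
begin

text \<open>
  With binary \<open>x\<close> and \<open>z\<close>, the equation \<open>x + (\<Sum>k. z k) = 1\<close> selects exactly one alternative: either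
  \<open>x = 1\<close>, and then \<open>r = 0\<close> while the positions \<open>q\<close> are arbitrary, or \<open>z k = 1\<close> for one pair \<open>k\<close>, and
  then \<open>r\<close> is at most the radius \<open>\<delta> - \<tau> k (q)\<close> that is left beyond \<open>k\<close>. Each alternative is a polytope
  (\<open>uncovered_branch\<close>, \<open>covered_branch\<close>), and both mixed-integer systems describe the union of these
  polytopes (\<open>bigM_system_binary\<close>, \<open>disjunctive_system_binary\<close>). For the big-M system, this is what
  validity of the constants is for: it makes the constraints of the alternatives that are not
  selected redundant.

  The relaxation of the disjunctive system is convex and contains the union, hence its hull.
  Conversely (\<open>relaxed_disjunctive_in_hull\<close>), a solution of the relaxation is a convex combination
  with weights \<open>x\<close> and \<open>z k\<close>: dividing the auxiliary variables of alternative \<open>k\<close> by \<open>z k\<close> gives a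
  point of the polytope of \<open>k\<close>, because \<open>residual\<close> is homogeneous and restricts to \<open>\<delta> - \<tau> k\<close> where
  its second argument is \<open>1\<close>. The only
  unusual feature is the treatment of the positions. The alternatives do not each carry a copy
  of the whole vector \<open>q\<close>; edge \<open>e\<close> has one variable \<open>qn e\<close> that is shared by all the alternatives
  not concerning \<open>e\<close>, whose joint weight is \<open>1 - (\<Sum>i. z (e, i))\<close>. This loses nothing, since those
  alternatives restrict the position on \<open>e\<close> to the same interval and can all use the same one,
  \<open>qn e\<close> divided by the joint weight.

  Finally, the relaxed big-M system is convex and contains the union, so it contains the hull.
\<close>

section \<open>Sums over pairs of an edge and a side\<close>

lemma binary_sum_one_cases:
  fixes z :: "'a \<Rightarrow> real"
  assumes "finite P" "x + sum z P = 1" "x \<in> {0, 1}" "\<And>k. k \<in> P \<Longrightarrow> z k \<in> {0, 1}"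
  obtains "x = 1" "\<And>k. k \<in> P \<Longrightarrow> z k = 0"
    | k where "x = 0" "k \<in> P" "z k = 1" "\<And>j. j \<in> P \<Longrightarrow> j \<noteq> k \<Longrightarrow> z j = 0"
proof (cases "x = 1")
  case True
  have nonneg: "0 \<le> z k" if "k \<in> P" for k using assms(4)[OF that] by auto
  have "sum z P = 0" using assms(2) True by simp
  then have "\<forall>k\<in>P. z k = 0" using sum_nonneg_eq_0_iff[OF assms(1), of z] nonneg by blast
  then show ?thesis using True that(1) by blast
next
  case False
  then have x: "x = 0" and s: "sum z P = 1" using assms(2,3) by auto
  have nonneg: "0 \<le> z k" if "k \<in> P" for k using assms(4)[OF that] by auto
  obtain k where k: "k \<in> P" "z k \<noteq> 0" using s by (metis sum.neutral zero_neq_one)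
  then have zk: "z k = 1" using assms(4) by auto
  have "sum z (P - {k}) = 0" using s zk k(1) by (simp add: sum.remove[OF assms(1) k(1)])
  moreover have "finite (P - {k})" using assms(1) by simp
  ultimately have "\<forall>j\<in>P - {k}. z j = 0"
    using sum_nonneg_eq_0_iff[of "P - {k}" z] nonneg by blast
  then show ?thesis using that(2)[OF x k(1) zk] by blast
qed

lemma sum_concentrated:
  fixes f :: "'a \<Rightarrow> 'b :: comm_monoid_add"
  assumes "finite P" "k \<in> P" "\<And>j. j \<in> P \<Longrightarrow> j \<noteq> k \<Longrightarrow> f j = 0"
  shows "sum f P = f k"
  using assms by (simp add: sum.remove[OF assms(1,2)])

lemma sum_fibre:
  fixes h :: "'a \<times> 'b :: finite \<Rightarrow> 'c :: comm_monoid_add"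
  assumes "finite P"
  shows "(\<Sum>i | (e, i) \<in> P. h (e, i)) = (\<Sum>k \<in> P. if fst k = e then h k else 0)"
proof -
  have "(\<Sum>k \<in> P. if fst k = e then h k else 0) = sum h {k \<in> P. fst k = e}"
    using assms by (simp add: sum.inter_filter)
  also have "{k \<in> P. fst k = e} = Pair e ` {i. (e, i) \<in> P}" by auto
  also have "sum h \<dots> = (\<Sum>i | (e, i) \<in> P. h (e, i))"
    by (simp add: sum.reindex inj_on_def)
  finally show ?thesis by simp
qed

lemma sum_fibre_concentrated:
  fixes f :: "'a \<times> 'b :: finite \<Rightarrow> real"
  assumes "finite P" "k \<in> P" "\<And>j. j \<in> P \<Longrightarrow> j \<noteq> k \<Longrightarrow> f j = 0"
  shows "(\<Sum>i | (e, i) \<in> P. f (e, i)) = (if fst k = e then f k else 0)"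
  unfolding sum_fibre[OF assms(1)]
  by (rule sum_concentrated[OF assms(1,2)]) (simp add: assms(3))

text \<open>
  In the decomposition of a relaxed solution, an alternative of weight zero need not supply a
  feasible point, because its scaled variables are quotients by zero.
\<close>

lemma convex_combination_in:
  fixes y :: "'a \<Rightarrow> 'b :: real_vector"
  assumes "convex C" "finite P" "x + sum w P = 1" "0 \<le> x" "\<And>k. k \<in> P \<Longrightarrow> 0 \<le> w k"
    and "y0 \<in> C" "\<And>k. k \<in> P \<Longrightarrow> 0 < w k \<Longrightarrow> y k \<in> C"
  shows "x *\<^sub>R y0 + (\<Sum>k \<in> P. w k *\<^sub>R y k) \<in> C"
proof -
  \<comment> \<open>a point of \<open>C\<close> in place of the alternatives of weight zero\<close>
  define y' where "y' k = (if 0 < w k then y k else y0)" for k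
  \<comment> \<open>one family for all the terms: \<open>None\<close> stands for the term with weight \<open>x\<close>\<close>
  let ?u = "case_option x w" and ?f = "case_option y0 y'"
  have "(\<Sum>j \<in> insert None (Some ` P). ?u j *\<^sub>R ?f j) \<in> C"
  proof (rule convex_sum)
    show "(\<Sum>j \<in> insert None (Some ` P). ?u j) = 1"
      using assms(2,3) by (simp add: sum.reindex)
  qed (use assms in \<open>auto simp: y'_def\<close>)
  moreover have "(\<Sum>k \<in> P. w k *\<^sub>R y' k) = (\<Sum>k \<in> P. w k *\<^sub>R y k)"
    by (rule sum.cong) (use assms(5) in \<open>force simp: y'_def\<close>)+
  ultimately show ?thesis
    using assms(2) by (simp add: sum.reindex)
qed

section \<open>The alternatives\<close>

text \<open>
  The function \<open>residual\<close> is the homogenization of \<open>\<delta> - tau\<close>: it agrees with it when the second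
  argument is \<open>1\<close>, and is linear in both arguments together. The agreement is what identifies
  the two mixed-integer systems, the linearity what makes the disjunctive relaxation tight.
\<close>

lemma residual_one: "residual E l \<delta> v k s 1 = \<delta> - tau E l v k s"
  by (cases "snd k") (auto simp: residual_def tau_def)

lemma residual_zero [simp]: "residual E l \<delta> v k 0 0 = 0"
  by (simp add: residual_def)

lemma residual_divide: "residual E l \<delta> v k (s / c) (y / c) = residual E l \<delta> v k s y / c"
  by (simp add: residual_def add_divide_distrib)

lemma residual_combination:
  "residual E l \<delta> v k (a * s + b * s') (a * y + b * y') =
     a * residual E l \<delta> v k s y + b * residual E l \<delta> v k s' y'"
  by (simp add: residual_def algebra_simps)

lemma tau_combination:
  assumes "a + b = 1"
  shows "tau E l v k (a * s + b * s') = a * tau E l v k s + b * tau E l v k s'"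
proof -
  have "b = 1 - a" using assms by simp
  show ?thesis unfolding \<open>b = 1 - a\<close> by (simp add: tau_def algebra_simps)
qed

lemma fst_partial_pairs: "k \<in> partial_pairs E l \<delta> v \<Longrightarrow> fst k \<in> partial_cover E l \<delta> v"
  by (auto simp: partial_pairs_def)

lemma partial_cover_subset: "partial_cover E l \<delta> v \<subseteq> E"
  by (auto simp: partial_cover_def potential_def)

definition positions ::
  "'v::finite edge set \<Rightarrow> ('v edge \<Rightarrow> real) \<Rightarrow> real \<Rightarrow> 'v \<Rightarrow> (real, 'v edge) vec set" where
  "positions E l \<delta> v =
     {q. (\<forall>e \<in> partial_cover E l \<delta> v. q $ e \<in> {0..l e}) \<and>
         (\<forall>e. e \<notin> partial_cover E l \<delta> v \<longrightarrow> q $ e = 0)}"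

definition uncovered_branch ::
  "'v::finite edge set \<Rightarrow> ('v edge \<Rightarrow> real) \<Rightarrow> real \<Rightarrow> 'v \<Rightarrow> 'v vars set" where
  "uncovered_branch E l \<delta> v = {(1, 0, 0, q) | q. q \<in> positions E l \<delta> v}"

definition covered_branch ::
  "'v::finite edge set \<Rightarrow> ('v edge \<Rightarrow> real) \<Rightarrow> real \<Rightarrow> 'v \<Rightarrow> 'v edge \<times> side \<Rightarrow> 'v vars set" where
  "covered_branch E l \<delta> v k =
     {(0, axis k 1, r, q) | r q.
        q \<in> positions E l \<delta> v \<and> 0 \<le> r \<and> r \<le> \<delta> - tau E l v k (q $ fst k)}"

definition branches ::
  "'v::finite edge set \<Rightarrow> ('v edge \<Rightarrow> real) \<Rightarrow> real \<Rightarrow> 'v \<Rightarrow> 'v vars set" where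
  "branches E l \<delta> v =
     uncovered_branch E l \<delta> v \<union> (\<Union>k \<in> partial_pairs E l \<delta> v. covered_branch E l \<delta> v k)"

lemma branches_cases:
  assumes "p \<in> branches E l \<delta> v"
  obtains q where "p = (1, 0, 0, q)" "q \<in> positions E l \<delta> v"
    | k r q where "p = (0, axis k 1, r, q)" "k \<in> partial_pairs E l \<delta> v"
        "q \<in> positions E l \<delta> v" "0 \<le> r" "r \<le> \<delta> - tau E l v k (q $ fst k)"
  using assms unfolding branches_def uncovered_branch_def covered_branch_def by blast

lemma uncovered_in_branches: "q \<in> positions E l \<delta> v \<Longrightarrow> (1, 0, 0, q) \<in> branches E l \<delta> v"
  by (auto simp: branches_def uncovered_branch_def)

lemma covered_in_branches:
  assumes "k \<in> partial_pairs E l \<delta> v" "q \<in> positions E l \<delta> v"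
    and "0 \<le> r" "r \<le> \<delta> - tau E l v k (q $ fst k)"
  shows "(0, axis k 1, r, q) \<in> branches E l \<delta> v"
  using assms by (auto simp: branches_def covered_branch_def)

lemma selection_cases:
  fixes E :: "'v::finite edge set" and x :: real
  assumes "\<And>k. k \<notin> partial_pairs E l \<delta> v \<Longrightarrow> z $ k = 0"
    and "x + (\<Sum>k \<in> partial_pairs E l \<delta> v. z $ k) = 1"
    and "x \<in> {0, 1}" "\<And>k. k \<in> partial_pairs E l \<delta> v \<Longrightarrow> z $ k \<in> {0, 1}"
  obtains "x = 1" "z = 0"
    | k where "x = 0" "k \<in> partial_pairs E l \<delta> v" "z = axis k 1"
proof (rule binary_sum_one_cases[OF finite assms(2-4)])
  assume "x = 1" "\<And>k. k \<in> partial_pairs E l \<delta> v \<Longrightarrow> z $ k = 0"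
  moreover from this have "z = 0" using assms(1) by (metis vec_eq_iff zero_index)
  ultimately show ?thesis using that(1) by blast
next
  fix k
  assume k: "x = 0" "k \<in> partial_pairs E l \<delta> v" "z $ k = 1"
    and other: "\<And>j. j \<in> partial_pairs E l \<delta> v \<Longrightarrow> j \<noteq> k \<Longrightarrow> z $ j = 0"
  have "z $ j = axis k 1 $ j" for j
    using k(3) other[of j] assms(1)[of j] by (cases "j = k") (auto simp: axis_def)
  then have "z = axis k 1" by (simp add: vec_eq_iff)
  then show ?thesis using that(2) k by blast
qed

section \<open>The mixed-integer systems\<close>

lemma disjunctive_systemI:
  fixes E :: "'v::finite edge set"
  assumes "(x, z, r, q) \<in> supported E l \<delta> v"
    and "x + (\<Sum>k \<in> partial_pairs E l \<delta> v. z $ k) = 1"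
    and "r = (\<Sum>k \<in> partial_pairs E l \<delta> v. rp k)"
    and "\<forall>e \<in> partial_cover E l \<delta> v.
           q $ e = qn e + (\<Sum>i | (e, i) \<in> partial_pairs E l \<delta> v. qp (e, i))"
    and "\<forall>k \<in> partial_pairs E l \<delta> v. rp k \<le> residual E l \<delta> v k (qp k) (z $ k)"
    and "\<forall>k \<in> partial_pairs E l \<delta> v. qp k \<le> z $ k * l (fst k)"
    and "\<forall>e \<in> partial_cover E l \<delta> v.
           qn e \<le> (1 - (\<Sum>i | (e, i) \<in> partial_pairs E l \<delta> v. z $ (e, i))) * l e"
    and "\<forall>k \<in> partial_pairs E l \<delta> v. z $ k \<in> S \<and> 0 \<le> rp k \<and> 0 \<le> qp k"
    and "\<forall>e \<in> partial_cover E l \<delta> v. 0 \<le> q $ e \<and> 0 \<le> qn e"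
    and "x \<in> S" "0 \<le> r"
  shows "(x, z, r, q) \<in> disjunctive_system S E l \<delta> v"
  unfolding disjunctive_system_def using assms by blast

lemma sum_axis:
  assumes "finite P" "k \<in> P"
  shows "(\<Sum>j \<in> P. (axis k (1::real)) $ j) = 1"
  using sum_concentrated[OF assms, of "\<lambda>j. axis k (1::real) $ j"] by (simp add: axis_def)

lemma sum_fibre_axis:
  fixes k :: "'a :: finite \<times> 'b :: finite"
  assumes "k \<in> P"
  shows "(\<Sum>i | (e, i) \<in> P. (axis k (1::real)) $ (e, i)) = of_bool (fst k = e)"
  using sum_fibre_concentrated[of P k "\<lambda>j. axis k (1::real) $ j" e] assms
  by (simp add: axis_def)

lemma bigM_system_binary:
  fixes E :: "'v::finite edge set"
  assumes M: "valid_bigM E l \<delta> v Mv M"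
  shows "bigM_system {0, 1} E l \<delta> v Mv M = branches E l \<delta> v"
proof (intro equalityI subsetI)
  fix p assume "p \<in> bigM_system {0, 1} E l \<delta> v Mv M"
  moreover obtain x z r q where p: "p = (x, z, r, q)" by (cases p)
  ultimately have p': "(x, z, r, q) \<in> bigM_system {0, 1} E l \<delta> v Mv M" by simp
  then have q: "q \<in> positions E l \<delta> v" and r: "0 \<le> r" "r \<le> Mv * (1 - x)"
    and c: "\<And>k. k \<in> partial_pairs E l \<delta> v \<Longrightarrow>
          r \<le> M k * (1 - z $ k) + \<delta> - tau E l v k (q $ fst k)"
    by (auto simp: bigM_system_def supported_def positions_def)
  show "p \<in> branches E l \<delta> v"
  proof (rule selection_cases)
    show "x + (\<Sum>k \<in> partial_pairs E l \<delta> v. z $ k) = 1"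
      "x \<in> {0, 1}" "\<And>k. k \<in> partial_pairs E l \<delta> v \<Longrightarrow> z $ k \<in> {0, 1}"
      "\<And>k. k \<notin> partial_pairs E l \<delta> v \<Longrightarrow> z $ k = 0"
      using p' unfolding bigM_system_def supported_def by blast+
  next
    assume "x = 1" "z = 0"
    then show ?thesis using p q r by (simp add: uncovered_in_branches)
  next
    fix k assume k: "x = 0" "k \<in> partial_pairs E l \<delta> v" "z = axis k 1"
    then have "r \<le> \<delta> - tau E l v k (q $ fst k)" using c[OF k(2)] by simp
    then show ?thesis using p q r k by (simp add: covered_in_branches)
  qed
next
  fix p assume "p \<in> branches E l \<delta> v"
  then show "p \<in> bigM_system {0, 1} E l \<delta> v Mv M"
  proof (cases rule: branches_cases)
    case (1 q)
    then have "\<forall>e \<in> partial_cover E l \<delta> v. q $ e \<in> {0..l e}" by (simp add: positions_def)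
    then have "0 \<le> M k + \<delta> - tau E l v k (q $ fst k)" if "k \<in> partial_pairs E l \<delta> v" for k
      using M that unfolding valid_bigM_def by blast
    then show ?thesis using 1 by (auto simp: bigM_system_def supported_def positions_def)
  next
    case (2 k r q)
    then have q: "\<forall>e \<in> partial_cover E l \<delta> v. q $ e \<in> {0..l e}" by (simp add: positions_def)
    have "r \<le> Mv" using M 2 q unfolding valid_bigM_def by blast
    moreover have "r \<le> M j * (1 - axis k 1 $ j) + \<delta> - tau E l v j (q $ fst j)"
      if j: "j \<in> partial_pairs E l \<delta> v" for j
    proof (cases "j = k")
      case False
      then have "r \<le> M j + \<delta> - tau E l v j (q $ fst j)"
        using M 2 q j unfolding valid_bigM_def by blast
      then show ?thesis using False by (simp add: axis_def)
    qed (use 2 in simp)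
    moreover have "axis k (1::real) $ j = 0" if "j \<notin> partial_pairs E l \<delta> v" for j
      using that 2 by (auto simp: axis_def)
    ultimately show ?thesis using 2
      by (auto simp: bigM_system_def supported_def positions_def sum_axis) (auto simp: axis_def)
  qed
qed

text \<open>
  These are the constraints on the auxiliary variables of a pair with \<open>z k = 0\<close>. In a binary
  solution they leave only the selected pair to contribute to \<open>r\<close>; in a relaxed one they justify
  dividing by \<open>z k\<close>.
\<close>

lemma disjunctive_zero_weight:
  assumes "rp \<le> residual E l \<delta> v k qp 0" "qp \<le> 0 * c" "0 \<le> rp" "0 \<le> qp"
  shows "rp = 0" "qp = 0"
  using assms by auto

lemma disjunctive_system_binary:
  fixes E :: "'v::finite edge set"
  shows "disjunctive_system {0, 1} E l \<delta> v = branches E l \<delta> v"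
proof (intro equalityI subsetI)
  fix p assume "p \<in> disjunctive_system {0, 1} E l \<delta> v"
  moreover obtain x z r q where p: "p = (x, z, r, q)" by (cases p)
  ultimately have p': "(x, z, r, q) \<in> disjunctive_system {0, 1} E l \<delta> v" by simp
  let ?P = "partial_pairs E l \<delta> v" and ?C = "partial_cover E l \<delta> v"
  from p' obtain rp qp qn where
    sel: "x + (\<Sum>k \<in> ?P. z $ k) = 1" "x \<in> {0, 1}" "\<And>k. k \<in> ?P \<Longrightarrow> z $ k \<in> {0, 1}"
      "\<And>k. k \<notin> ?P \<Longrightarrow> z $ k = 0"
    and q0: "\<And>e. e \<notin> ?C \<Longrightarrow> q $ e = 0"
    and r: "r = (\<Sum>k \<in> ?P. rp k)"
    and q: "\<And>e. e \<in> ?C \<Longrightarrow> q $ e = qn e + (\<Sum>i | (e, i) \<in> ?P. qp (e, i))"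
    and rp: "\<And>k. k \<in> ?P \<Longrightarrow> rp k \<le> residual E l \<delta> v k (qp k) (z $ k)"
    and qp: "\<And>k. k \<in> ?P \<Longrightarrow> qp k \<le> z $ k * l (fst k)"
    and qn: "\<And>e. e \<in> ?C \<Longrightarrow> qn e \<le> (1 - (\<Sum>i | (e, i) \<in> ?P. z $ (e, i))) * l e"
    and pos: "\<And>k. k \<in> ?P \<Longrightarrow> 0 \<le> rp k" "\<And>k. k \<in> ?P \<Longrightarrow> 0 \<le> qp k" "\<And>e. e \<in> ?C \<Longrightarrow> 0 \<le> qn e"
    unfolding disjunctive_system_def supported_def by blast
  have vanish: "rp k = 0" "qp k = 0" if "k \<in> ?P" "z $ k = 0" for k
    using disjunctive_zero_weight[of "rp k" E l \<delta> v k "qp k" "l (fst k)"]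
      rp[OF that(1)] qp[OF that(1)] pos(1,2)[OF that(1)] that(2) by simp_all
  show "p \<in> branches E l \<delta> v"
  proof (rule selection_cases[OF sel(4,1-3)])
    assume xz: "x = 1" "z = 0"
    have "q $ e \<in> {0..l e}" if "e \<in> ?C" for e
      using q[OF that] qn[OF that] pos(3)[OF that] xz vanish by simp
    then have "q \<in> positions E l \<delta> v" using q0 by (simp add: positions_def)
    moreover have "r = 0" using r vanish xz by simp
    ultimately show ?thesis using p xz by (simp add: uncovered_in_branches)
  next
    fix k assume k: "x = 0" "k \<in> ?P" "z = axis k 1"
    have zj: "z $ j = 0" if "j \<noteq> k" for j using k that by (simp add: axis_def)
    have qe: "q $ e = qn e + (if fst k = e then qp k else 0)" if "e \<in> ?C" for e
      using q[OF that] sum_fibre_concentrated[of ?P k qp e] k vanish zj by simp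
    have qne: "qn e \<le> (1 - of_bool (fst k = e)) * l e" if "e \<in> ?C" for e
      using qn[OF that] sum_fibre_axis[OF k(2)] k by simp
    have qk: "qp k \<le> l (fst k)" using qp[OF k(2)] k by simp
    have "q $ e \<in> {0..l e}" if "e \<in> ?C" for e
      using qe[OF that] qne[OF that] qk pos(3)[OF that] pos(2)[OF k(2)]
      by (cases "fst k = e") auto
    then have "q \<in> positions E l \<delta> v" using q0 by (simp add: positions_def)
    moreover have "q $ fst k = qp k"
      using qe[of "fst k"] qne[of "fst k"] pos(3)[of "fst k"] fst_partial_pairs[OF k(2)] by simp
    moreover have "r = rp k" unfolding r
      by (rule sum_concentrated) (use k vanish zj in auto)
    ultimately show ?thesis using p k rp[OF k(2)] pos(1)[OF k(2)]
      by (simp add: covered_in_branches residual_one)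
  qed
next
  fix p assume "p \<in> branches E l \<delta> v"
  then show "p \<in> disjunctive_system {0, 1} E l \<delta> v"
  proof (cases rule: branches_cases)
    case (1 q)
    then show ?thesis unfolding disjunctive_system_def supported_def positions_def
      by (auto intro!: exI[of _ "\<lambda>_. 0"] exI[of _ "\<lambda>e. q $ e"])
  next
    case (2 k r q)
    let ?P = "partial_pairs E l \<delta> v" and ?C = "partial_cover E l \<delta> v"
    \<comment> \<open>the edge of \<open>k\<close> has its position in \<open>qp\<close>, every other edge in \<open>qn\<close>\<close>
    define rp where "rp j = (if j = k then r else 0)" for j
    define qp where "qp j = (if j = k then q $ fst k else 0)" for j
    define qn where "qn e = (if e = fst k then 0 else q $ e)" for e
    have q: "\<And>e. e \<in> ?C \<Longrightarrow> 0 \<le> q $ e \<and> q $ e \<le> l e" "\<And>e. e \<notin> ?C \<Longrightarrow> q $ e = 0"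
      using 2 by (auto simp: positions_def)
    have qk: "0 \<le> q $ fst k" "q $ fst k \<le> l (fst k)"
      using q(1)[OF fst_partial_pairs] 2(2) by blast+
    have z: "axis k (1::real) $ j = of_bool (j = k)" for j by (simp add: axis_def)
    have "r = sum rp ?P" using sum_concentrated[of ?P k rp] 2 by (simp add: rp_def)
    moreover have "(\<Sum>i | (e, i) \<in> ?P. qp (e, i)) = (if fst k = e then q $ fst k else 0)" for e
      using sum_fibre_concentrated[of ?P k qp e] 2 by (simp add: qp_def)
    then have "\<forall>e \<in> ?C. q $ e = qn e + (\<Sum>i | (e, i) \<in> ?P. qp (e, i))"
      by (auto simp: qn_def)
    moreover have "\<forall>j \<in> ?P. rp j \<le> residual E l \<delta> v j (qp j) (axis k 1 $ j)"
      using 2 by (auto simp: rp_def qp_def z residual_one)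
    moreover have "\<forall>j \<in> ?P. qp j \<le> axis k 1 $ j * l (fst j)"
      using qk by (simp add: qp_def z)
    moreover have "\<forall>e \<in> ?C. qn e \<le> (1 - (\<Sum>i | (e, i) \<in> ?P. axis k 1 $ (e, i))) * l e"
      using q 2 by (auto simp: qn_def sum_fibre_axis)
    moreover have "\<forall>j \<in> ?P. axis k 1 $ j \<in> {0, 1::real} \<and> 0 \<le> rp j \<and> 0 \<le> qp j"
      using qk 2 by (simp add: rp_def qp_def z)
    moreover have "\<forall>e \<in> ?C. 0 \<le> q $ e \<and> 0 \<le> qn e" using q by (auto simp: qn_def)
    moreover have "(0, axis k 1, r, q) \<in> supported E l \<delta> v"
      using 2 q by (auto simp: supported_def z)
    moreover have "0 + (\<Sum>j \<in> ?P. axis k (1::real) $ j) = 1" using sum_axis[of ?P k] 2 by simp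
    ultimately show ?thesis unfolding 2(1)
      using 2(4) by (intro disjunctive_systemI[where rp = rp and qp = qp and qn = qn]) auto
  qed
qed

section \<open>Convexity of the relaxations\<close>

lemma supported_combination:
  fixes E :: "'v::finite edge set"
  assumes "(x, z, r, q) \<in> supported E l \<delta> v" "(x', z', r', q') \<in> supported E l \<delta> v"
  shows "(y, a *\<^sub>R z + b *\<^sub>R z', s, a *\<^sub>R q + b *\<^sub>R q') \<in> supported E l \<delta> v"
  using assms by (simp add: supported_def)

lemma combination_in_interval:
  fixes a b :: real
  assumes "0 \<le> a" "0 \<le> b" "a + b = 1" "s \<in> {0..c}" "t \<in> {0..c}"
  shows "a * s + b * t \<in> {0..c}"
  using convexD[OF convex_real_interval(5)[of 0 c] assms(4,5,1-3)] by simp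

lemma combination_mono:
  fixes a b :: real
  assumes "0 \<le> a" "0 \<le> b" "s \<le> s'" "t \<le> t'"
  shows "a * s + b * t \<le> a * s' + b * t'"
  by (intro add_mono mult_left_mono assms)

lemma sum_combination:
  fixes a b :: real
  shows "(\<Sum>k \<in> P. a * f k + b * g k) = a * sum f P + b * sum g P"
  by (simp add: sum.distrib sum_distrib_left)

lemma convex_relaxed_bigM: "convex (bigM_system {0..1} E l \<delta> v Mv M)"
proof (rule convexI)
  fix p p' :: "'a vars" and a b :: real
  assume mem: "p \<in> bigM_system {0..1} E l \<delta> v Mv M" "p' \<in> bigM_system {0..1} E l \<delta> v Mv M"
    and ab: "0 \<le> a" "0 \<le> b" "a + b = 1"
  obtain x z r q x' z' r' q' where p: "p = (x, z, r, q)" "p' = (x', z', r', q')"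
    by (cases p, cases p')
  let ?P = "partial_pairs E l \<delta> v" and ?C = "partial_cover E l \<delta> v"
  note comb = combination_mono[OF ab(1,2)] combination_in_interval[OF ab]
  have b: "b = 1 - a" using ab by simp
  have sup: "(x, z, r, q) \<in> supported E l \<delta> v" "(x', z', r', q') \<in> supported E l \<delta> v"
    and sel: "x + (\<Sum>k \<in> ?P. z $ k) = 1" "x' + (\<Sum>k \<in> ?P. z' $ k) = 1"
    and r: "r \<le> Mv * (1 - x)" "r' \<le> Mv * (1 - x')"
    and c: "\<And>k. k \<in> ?P \<Longrightarrow> r \<le> M k * (1 - z $ k) + \<delta> - tau E l v k (q $ fst k)"
      "\<And>k. k \<in> ?P \<Longrightarrow> r' \<le> M k * (1 - z' $ k) + \<delta> - tau E l v k (q' $ fst k)"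
    and z: "\<And>k. k \<in> ?P \<Longrightarrow> z $ k \<in> {0..1}" "\<And>k. k \<in> ?P \<Longrightarrow> z' $ k \<in> {0..1}"
    and q: "\<And>e. e \<in> ?C \<Longrightarrow> q $ e \<in> {0..l e}" "\<And>e. e \<in> ?C \<Longrightarrow> q' $ e \<in> {0..l e}"
    and xr: "x \<in> {0..1}" "x' \<in> {0..1}" "0 \<le> r" "0 \<le> r'"
    using mem unfolding p bigM_system_def by blast+
  have "a * x + b * x' + (\<Sum>k \<in> ?P. a * z $ k + b * z' $ k)
      = a * (x + (\<Sum>k \<in> ?P. z $ k)) + b * (x' + (\<Sum>k \<in> ?P. z' $ k))"
    by (simp add: sum_combination algebra_simps)
  then have 1: "a * x + b * x' + (\<Sum>k \<in> ?P. a * z $ k + b * z' $ k) = 1"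
    using sel ab by simp
  have 2: "a * r + b * r' \<le> Mv * (1 - (a * x + b * x'))"
    using comb(1)[OF r] by (simp add: b algebra_simps)
  have 3: "a * r + b * r' \<le> M k * (1 - (a * z $ k + b * z' $ k)) + \<delta>
      - tau E l v k (a * q $ fst k + b * q' $ fst k)" if "k \<in> ?P" for k
    using comb(1)[OF c(1)[OF that] c(2)[OF that]]
    unfolding tau_combination[OF ab(3)] by (simp add: b algebra_simps)
  have 4: "\<forall>k \<in> ?P. a * z $ k + b * z' $ k \<in> {0..1}" "\<forall>e \<in> ?C. a * q $ e + b * q' $ e \<in> {0..l e}"
    "a * x + b * x' \<in> {0..1}" "0 \<le> a * r + b * r'"
    using z q comb(2)[OF xr(1,2)] xr(3,4) ab by (blast intro: comb(2), blast intro: comb(2), simp_all)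
  show "a *\<^sub>R p + b *\<^sub>R p' \<in> bigM_system {0..1} E l \<delta> v Mv M"
    using 1 2 3 4 supported_combination[OF sup]
    unfolding p bigM_system_def by simp
qed

lemma convex_relaxed_disjunctive: "convex (disjunctive_system {0..1} E l \<delta> v)"
proof (rule convexI)
  fix p p' :: "'a vars" and a b :: real
  assume mem: "p \<in> disjunctive_system {0..1} E l \<delta> v" "p' \<in> disjunctive_system {0..1} E l \<delta> v"
    and ab: "0 \<le> a" "0 \<le> b" "a + b = 1"
  obtain x z r q x' z' r' q' where p: "p = (x, z, r, q)" "p' = (x', z', r', q')"
    by (cases p, cases p')
  let ?P = "partial_pairs E l \<delta> v" and ?C = "partial_cover E l \<delta> v"
  note comb = combination_mono[OF ab(1,2)] combination_in_interval[OF ab]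
  have b: "b = 1 - a" using ab by simp
  from mem(1) obtain rp qp qn where
    sup: "(x, z, r, q) \<in> supported E l \<delta> v" and
    sel: "x + (\<Sum>k \<in> ?P. z $ k) = 1" and
    r: "r = (\<Sum>k \<in> ?P. rp k)" and
    q: "\<And>e. e \<in> ?C \<Longrightarrow> q $ e = qn e + (\<Sum>i | (e, i) \<in> ?P. qp (e, i))" and
    rp: "\<And>k. k \<in> ?P \<Longrightarrow> rp k \<le> residual E l \<delta> v k (qp k) (z $ k)" and
    qp: "\<And>k. k \<in> ?P \<Longrightarrow> qp k \<le> z $ k * l (fst k)" and
    qn: "\<And>e. e \<in> ?C \<Longrightarrow> qn e \<le> (1 - (\<Sum>i | (e, i) \<in> ?P. z $ (e, i))) * l e" and
    posp: "\<And>k. k \<in> ?P \<Longrightarrow> z $ k \<in> {0..1} \<and> 0 \<le> rp k \<and> 0 \<le> qp k" and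
    pose: "\<And>e. e \<in> ?C \<Longrightarrow> 0 \<le> q $ e \<and> 0 \<le> qn e" and
    xr: "x \<in> {0..1}" "0 \<le> r"
    unfolding p disjunctive_system_def by blast
  from mem(2) obtain rp' qp' qn' where
    sup': "(x', z', r', q') \<in> supported E l \<delta> v" and
    sel': "x' + (\<Sum>k \<in> ?P. z' $ k) = 1" and
    r': "r' = (\<Sum>k \<in> ?P. rp' k)" and
    q': "\<And>e. e \<in> ?C \<Longrightarrow> q' $ e = qn' e + (\<Sum>i | (e, i) \<in> ?P. qp' (e, i))" and
    rp': "\<And>k. k \<in> ?P \<Longrightarrow> rp' k \<le> residual E l \<delta> v k (qp' k) (z' $ k)" and
    qp': "\<And>k. k \<in> ?P \<Longrightarrow> qp' k \<le> z' $ k * l (fst k)" and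
    qn': "\<And>e. e \<in> ?C \<Longrightarrow> qn' e \<le> (1 - (\<Sum>i | (e, i) \<in> ?P. z' $ (e, i))) * l e" and
    posp': "\<And>k. k \<in> ?P \<Longrightarrow> z' $ k \<in> {0..1} \<and> 0 \<le> rp' k \<and> 0 \<le> qp' k" and
    pose': "\<And>e. e \<in> ?C \<Longrightarrow> 0 \<le> q' $ e \<and> 0 \<le> qn' e" and
    xr': "x' \<in> {0..1}" "0 \<le> r'"
    unfolding p disjunctive_system_def by blast
  let ?rp = "\<lambda>k. a * rp k + b * rp' k" and ?qp = "\<lambda>k. a * qp k + b * qp' k"
    and ?qn = "\<lambda>e. a * qn e + b * qn' e" and ?z = "a *\<^sub>R z + b *\<^sub>R z'" and ?q = "a *\<^sub>R q + b *\<^sub>R q'"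
  have nonneg: "0 \<le> a * s + b * t" if "0 \<le> s" "0 \<le> t" for s t using that ab by simp
  have "a * x + b * x' + (\<Sum>k \<in> ?P. a * z $ k + b * z' $ k)
      = a * (x + (\<Sum>k \<in> ?P. z $ k)) + b * (x' + (\<Sum>k \<in> ?P. z' $ k))"
    by (simp add: sum_combination algebra_simps)
  then have "a * x + b * x' + (\<Sum>k \<in> ?P. ?z $ k) = 1"
    using sel sel' ab by simp
  moreover have "a * r + b * r' = (\<Sum>k \<in> ?P. ?rp k)"
    by (simp add: r r' sum_combination)
  moreover have "\<forall>e \<in> ?C. ?q $ e = ?qn e + (\<Sum>i | (e, i) \<in> ?P. ?qp (e, i))"
    by (simp add: q q' sum_combination algebra_simps)
  moreover have "\<forall>k \<in> ?P. ?rp k \<le> residual E l \<delta> v k (?qp k) (?z $ k)"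
    using comb(1)[OF rp rp'] by (simp add: residual_combination)
  moreover have "\<forall>k \<in> ?P. ?qp k \<le> ?z $ k * l (fst k)"
    using comb(1)[OF qp qp'] by (simp add: algebra_simps)
  moreover have "\<forall>e \<in> ?C. ?qn e \<le> (1 - (\<Sum>i | (e, i) \<in> ?P. ?z $ (e, i))) * l e"
  proof
    fix e assume e: "e \<in> ?C"
    have "(\<Sum>i | (e, i) \<in> ?P. ?z $ (e, i))
        = a * (\<Sum>i | (e, i) \<in> ?P. z $ (e, i)) + b * (\<Sum>i | (e, i) \<in> ?P. z' $ (e, i))"
      by (simp add: sum_combination)
    moreover have "?qn e \<le> a * ((1 - (\<Sum>i | (e, i) \<in> ?P. z $ (e, i))) * l e)
        + b * ((1 - (\<Sum>i | (e, i) \<in> ?P. z' $ (e, i))) * l e)"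
      using comb(1)[OF qn[OF e] qn'[OF e]] .
    ultimately show "?qn e \<le> (1 - (\<Sum>i | (e, i) \<in> ?P. ?z $ (e, i))) * l e"
      by (simp only: b) (simp only: algebra_simps)
  qed
  moreover have "\<forall>k \<in> ?P. ?z $ k \<in> {0..1} \<and> 0 \<le> ?rp k \<and> 0 \<le> ?qp k"
    using comb(2)[of _ 1] posp posp' nonneg by simp
  moreover have "\<forall>e \<in> ?C. 0 \<le> ?q $ e \<and> 0 \<le> ?qn e"
    using pose pose' nonneg by simp
  moreover have "a * x + b * x' \<in> {0..1}" "0 \<le> a * r + b * r'"
    using comb(2)[OF xr(1) xr'(1)] nonneg[OF xr(2) xr'(2)] .
  moreover note supported_combination[OF sup sup', of "a * x + b * x'" a b "a * r + b * r'"]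
  ultimately have "(a * x + b * x', ?z, a * r + b * r', ?q) \<in> disjunctive_system {0..1} E l \<delta> v"
    by (intro disjunctive_systemI[where rp = ?rp and qp = ?qp and qn = ?qn])
  then show "a *\<^sub>R p + b *\<^sub>R p' \<in> disjunctive_system {0..1} E l \<delta> v"
    by (simp add: p)
qed

lemma disjunctive_system_mono:
  assumes "S \<subseteq> T"
  shows "disjunctive_system S E l \<delta> v \<subseteq> disjunctive_system T E l \<delta> v"
  using assms unfolding disjunctive_system_def by blast

lemma bigM_system_mono:
  assumes "S \<subseteq> T"
  shows "bigM_system S E l \<delta> v Mv M \<subseteq> bigM_system T E l \<delta> v Mv M"
  using assms unfolding bigM_system_def by blast

section \<open>Decomposition of relaxed solutions\<close>

text \<open>
  A relaxed solution is the combination, with weights \<open>x\<close> and \<open>z k\<close>, of one point per alternative.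
  On an edge \<open>e\<close> that alternative \<open>k\<close> concerns, its point has position \<open>qp k / z k\<close>; on every other
  edge it has the common position \<open>qn e / (1 - (\<Sum>i. z (e, i)))\<close>. If a denominator is zero, the
  constraints force the numerator to be zero too, so that multiplying by the weight still gives
  back the original variable.
\<close>

lemma relaxed_disjunctive_in_hull:
  fixes E :: "'v::finite edge set"
  assumes l: "\<And>e. e \<in> partial_cover E l \<delta> v \<Longrightarrow> 0 \<le> l e"
  shows "disjunctive_system {0..1} E l \<delta> v \<subseteq> convex hull (branches E l \<delta> v)"
proof
  fix p assume "p \<in> disjunctive_system {0..1} E l \<delta> v"
  moreover obtain x z r q where p: "p = (x, z, r, q)" by (cases p)
  ultimately have p': "(x, z, r, q) \<in> disjunctive_system {0..1} E l \<delta> v" by simp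
  let ?P = "partial_pairs E l \<delta> v" and ?C = "partial_cover E l \<delta> v"
  define \<sigma> where "\<sigma> e = (\<Sum>i | (e, i) \<in> ?P. z $ (e, i))" for e
  from p' obtain rp qp qn where
    sel: "x + (\<Sum>k \<in> ?P. z $ k) = 1" "0 \<le> x" "\<And>k. k \<in> ?P \<Longrightarrow> 0 \<le> z $ k"
      "\<And>k. k \<notin> ?P \<Longrightarrow> z $ k = 0"
    and q0: "\<And>e. e \<notin> ?C \<Longrightarrow> q $ e = 0"
    and r: "r = (\<Sum>k \<in> ?P. rp k)"
    and q: "\<And>e. e \<in> ?C \<Longrightarrow> q $ e = qn e + (\<Sum>i | (e, i) \<in> ?P. qp (e, i))"
    and rp: "\<And>k. k \<in> ?P \<Longrightarrow> rp k \<le> residual E l \<delta> v k (qp k) (z $ k)"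
    and qp: "\<And>k. k \<in> ?P \<Longrightarrow> qp k \<le> z $ k * l (fst k)"
    and qn: "\<And>e. e \<in> ?C \<Longrightarrow> qn e \<le> (1 - \<sigma> e) * l e"
    and pos: "\<And>k. k \<in> ?P \<Longrightarrow> 0 \<le> rp k" "\<And>k. k \<in> ?P \<Longrightarrow> 0 \<le> qp k" "\<And>e. e \<in> ?C \<Longrightarrow> 0 \<le> qn e"
    unfolding disjunctive_system_def supported_def \<sigma>_def atLeastAtMost_iff by blast
  have vanish: "rp k = 0" "qp k = 0" if "k \<in> ?P" "z $ k = 0" for k
    using disjunctive_zero_weight[of "rp k" E l \<delta> v k "qp k" "l (fst k)"]
      rp[OF that(1)] qp[OF that(1)] pos(1,2)[OF that(1)] that(2) by simp_all
  have \<sigma>: "\<sigma> e = (\<Sum>k \<in> ?P. if fst k = e then z $ k else 0)" for e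
    unfolding \<sigma>_def by (rule sum_fibre) simp
  have "\<sigma> e \<le> (\<Sum>k \<in> ?P. z $ k)" for e
    unfolding \<sigma> by (rule sum_mono) (simp add: sel)
  then have \<sigma>_le: "\<sigma> e \<le> 1" for e using sel(1,2) order.trans[of "\<sigma> e" "\<Sum>k \<in> ?P. z $ k" 1] by simp
  define common where "common e = qn e / (1 - \<sigma> e)" for e
  define pos0 :: "(real, 'v edge) vec" where "pos0 = (\<chi> e. if e \<in> ?C then common e else 0)"
  define posk :: "'v edge \<times> side \<Rightarrow> (real, 'v edge) vec" where
    "posk k = (\<chi> e. if e \<in> ?C then if fst k = e then qp k / z $ k else common e else 0)" for k
  have common: "common e \<in> {0..l e}" if "e \<in> ?C" for e
    using qn[OF that] pos(3)[OF that] l[OF that] \<sigma>_le[of e]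
    by (cases "\<sigma> e = 1") (auto simp: common_def divide_le_eq mult.commute)
  have common_weight: "(1 - \<sigma> e) * common e = qn e" if "e \<in> ?C" for e
    using qn[OF that] pos(3)[OF that] by (cases "\<sigma> e = 1") (auto simp: common_def)
  let ?unc = "(1, 0, 0, pos0) :: 'v vars"
  let ?cov = "\<lambda>k. (0, axis k 1, rp k / z $ k, posk k) :: 'v vars"
  have y0: "?unc \<in> branches E l \<delta> v"
    by (rule uncovered_in_branches) (use common in \<open>auto simp: positions_def pos0_def\<close>)
  have y: "?cov k \<in> branches E l \<delta> v" if k: "k \<in> ?P" and zk: "0 < z $ k" for k
  proof (rule covered_in_branches[OF k])
    have "qp k / z $ k \<in> {0..l (fst k)}"
      using qp[OF k] pos(2)[OF k] zk by (simp add: divide_le_eq mult.commute)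
    then show "posk k \<in> positions E l \<delta> v"
      using common by (auto simp: positions_def posk_def)
    show "0 \<le> rp k / z $ k" using pos(1)[OF k] zk by simp
    have "rp k / z $ k \<le> residual E l \<delta> v k (qp k) (z $ k) / z $ k"
      using rp[OF k] zk by (intro divide_right_mono) auto
    also have "\<dots> = residual E l \<delta> v k (qp k / z $ k) (z $ k / z $ k)"
      by (simp only: residual_divide)
    also have "\<dots> = \<delta> - tau E l v k (posk k $ fst k)"
      using zk fst_partial_pairs[OF k] by (simp add: residual_one posk_def)
    finally show "rp k / z $ k \<le> \<delta> - tau E l v k (posk k $ fst k)" .
  qed
  have zsum: "(\<Sum>k \<in> ?P. z $ k * axis k 1 $ j) = z $ j" for j
  proof (cases "j \<in> ?P")
    case True
    then show ?thesis using sum_concentrated[of ?P j "\<lambda>k. z $ k * axis k 1 $ j"]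
      by (simp add: axis_def)
  next
    case False
    then have "(\<Sum>k \<in> ?P. z $ k * axis k 1 $ j) = 0"
      by (intro sum.neutral) (auto simp: axis_def)
    then show ?thesis using False sel(4) by simp
  qed
  have rsum: "(\<Sum>k \<in> ?P. z $ k * (rp k / z $ k)) = r"
    unfolding r by (rule sum.cong) (use vanish in auto)
  have qsum: "x * pos0 $ e + (\<Sum>k \<in> ?P. z $ k * posk k $ e) = q $ e" for e
  proof (cases "e \<in> ?C")
    case True
    \<comment> \<open>the common position would have weight \<open>z k\<close> in every term; those with \<open>fst k = e\<close> are corrected\<close>
    have "(\<Sum>k \<in> ?P. z $ k * posk k $ e)
        = (\<Sum>k \<in> ?P. (if fst k = e then qp k else 0)
             + common e * (z $ k - (if fst k = e then z $ k else 0)))"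
      by (rule sum.cong) (use vanish True in \<open>auto simp: posk_def\<close>)
    also have "\<dots> = (\<Sum>i | (e, i) \<in> ?P. qp (e, i)) + common e * ((\<Sum>k \<in> ?P. z $ k) - \<sigma> e)"
      by (simp only: sum.distrib sum_distrib_left[symmetric] sum_subtractf \<sigma> sum_fibre[OF finite])
    also have "(\<Sum>k \<in> ?P. z $ k) = 1 - x" using sel(1) by simp
    finally have "x * pos0 $ e + (\<Sum>k \<in> ?P. z $ k * posk k $ e)
        = (\<Sum>i | (e, i) \<in> ?P. qp (e, i)) + (1 - \<sigma> e) * common e"
      using True by (simp add: pos0_def algebra_simps)
    then show ?thesis using q[OF True] common_weight[OF True] by simp
  next
    case False
    then show ?thesis using q0 by (simp add: pos0_def posk_def)
  qed
  have "x *\<^sub>R ?unc + (\<Sum>k \<in> ?P. z $ k *\<^sub>R ?cov k) \<in> convex hull (branches E l \<delta> v)"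
    by (rule convex_combination_in[OF convex_convex_hull finite sel(1-3)])
      (use y0 y in \<open>auto intro: hull_inc\<close>)
  moreover have "x *\<^sub>R ?unc + (\<Sum>k \<in> ?P. z $ k *\<^sub>R ?cov k) = p"
    using zsum rsum qsum
    by (auto simp: p prod_eq_iff fst_sum snd_sum vec_eq_iff)
  ultimately show "p \<in> convex hull (branches E l \<delta> v)" by simp
qed

theorem theorem1:
  fixes E :: "'v :: {finite, linorder} edge set"
    and l :: "'v edge \<Rightarrow> real"
    and \<delta> :: real
    and v :: 'v
    and Mv :: real
    and M :: "'v edge \<times> side \<Rightarrow> real"
  assumes "network E l"
    and "\<delta> > 0"
    and "\<forall>e \<in> E. l e \<le> \<delta>"
    and "valid_bigM E l \<delta> v Mv M"
  shows "bigM_system {0, 1} E l \<delta> v Mv M = disjunctive_system {0, 1} E l \<delta> v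
       \<and> disjunctive_system {0, 1} E l \<delta> v \<subseteq> convex hull (disjunctive_system {0, 1} E l \<delta> v)
       \<and> convex hull (disjunctive_system {0, 1} E l \<delta> v) = disjunctive_system {0..1} E l \<delta> v
       \<and> disjunctive_system {0..1} E l \<delta> v \<subseteq> bigM_system {0..1} E l \<delta> v Mv M"
proof -
  interpret network E l by fact
  let ?B = "branches E l \<delta> v"
  have bigM: "bigM_system {0, 1} E l \<delta> v Mv M = ?B"
    using assms(4) by (rule bigM_system_binary)
  have disj: "disjunctive_system {0, 1} E l \<delta> v = ?B"
    by (rule disjunctive_system_binary)
  have "0 \<le> l e" if "e \<in> partial_cover E l \<delta> v" for e
    using that partial_cover_subset[of E l \<delta> v] length_nonneg by blast
  then have "disjunctive_system {0..1} E l \<delta> v \<subseteq> convex hull ?B"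
    by (rule relaxed_disjunctive_in_hull)
  moreover have "convex hull ?B \<subseteq> disjunctive_system {0..1} E l \<delta> v"
    using disjunctive_system_mono[of "{0, 1}" "{0..1}" E l \<delta> v] convex_relaxed_disjunctive
    by (intro hull_minimal) (simp_all add: disj)
  moreover have "convex hull ?B \<subseteq> bigM_system {0..1} E l \<delta> v Mv M"
    using bigM_system_mono[of "{0, 1}" "{0..1}" E l \<delta> v Mv M] convex_relaxed_bigM
    by (intro hull_minimal) (simp_all add: bigM)
  ultimately show ?thesis
    using bigM disj hull_subset[of ?B convex] by auto
qed

end
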